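(* Let $n=1+n_2+n_3=p+q$ with $n_2,n_3,p,q$ positive integers, let $G=U(n)$, and let $L=U(1)\times U(n_2)\times U(n_3)$ and $H=U(p)\times U(q)$ be the natural block-diagonal subgroups of $G$. Set $l:=\min(2p,2q,2n_2+1,2n_3+1)$ (so $[\tfrac l2]=\min(p,q,n_2,n_3)$ and $[\tfrac{l+1}2]=\min(p,q,n_2+1,n_3+1)$). Define the abelian subspaces of $\mathfrak{u}(n)$ $$\mathfrak b':=\sum_{i=1}^{[\frac{l+1}2]}\mathbb{R}(E_{i,n+1-i}-E_{n+1-i,i}),\qquad \mathfrak b'':=\sum_{i=1}^{[\frac l2]}\mathbb{R}(E_{i+1,n+1-i}-E_{n+1-i,i+1}),$$ the toral subgroups $B':=\exp\mathfrak b'$ and $B'':=\exp\mathfrak b''$ of $O(n)$, and the subset $B:=B''B'=\{xy:x\in B'',y\in B'\}\subset O(n)$. Then $G=LBH$.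
   Context: $E_{ij}$ denotes the $n\times n$ matrix unit with $1$ in position $(i,j)$ and $0$ elsewhere; $[x]$ denotes the integer part of $x$. $LBH=\{xbh:x\in L,b\in B,h\in H\}$. *)

theory Defs
  imports Complex_Main "Jordan_Normal_Form.Matrix"
begin

definition ctrans :: "complex mat \<Rightarrow> complex mat" where
  "ctrans A = mat (dim_col A) (dim_row A) (\<lambda>(i,j). cnj (A $$ (j,i)))"

definition unitary_grp :: "nat \<Rightarrow> complex mat set" where
  "unitary_grp n = {U \<in> carrier_mat n n. U * ctrans U = 1\<^sub>m n}"

text \<open>Block-diagonal unitary matrices: entries vanish unless row and column
  lie in the same block; blk assigns a block label to each 0-based index.\<close>
definition block_unitary :: "nat \<Rightarrow> (nat \<Rightarrow> nat) \<Rightarrow> complex mat set" where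
  "block_unitary n blk = {U \<in> unitary_grp n. \<forall>i<n. \<forall>j<n. blk i \<noteq> blk j \<longrightarrow> U $$ (i,j) = 0}"

text \<open>L = U(1) x U(n2) x U(n3): blocks {1}, {2..1+n2}, {2+n2..n} (1-based).\<close>
definition L_grp :: "nat \<Rightarrow> nat \<Rightarrow> complex mat set" where
  "L_grp n2 n3 = block_unitary (1 + n2 + n3)
     (\<lambda>i. if i = 0 then 0 else if i \<le> n2 then 1 else 2)"

text \<open>H = U(p) x U(q): blocks {1..p}, {p+1..p+q} (1-based).\<close>
definition H_grp :: "nat \<Rightarrow> nat \<Rightarrow> complex mat set" where
  "H_grp p q = block_unitary (p + q) (\<lambda>i. if i < p then 0 else 1)"

text \<open>Matrix unit E_{ij} (1-based indices) of size n.\<close>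
definition Eunit :: "nat \<Rightarrow> nat \<Rightarrow> nat \<Rightarrow> complex mat" where
  "Eunit n i j = mat n n (\<lambda>(a,b). if a = i - 1 \<and> b = j - 1 then 1 else 0)"

definition mexp :: "complex mat \<Rightarrow> complex mat" where
  "mexp A = mat (dim_row A) (dim_col A)
     (\<lambda>(i,j). \<Sum>k. (A ^\<^sub>m k) $$ (i,j) / of_nat (fact k))"

definition b1 :: "nat \<Rightarrow> nat \<Rightarrow> complex mat set" where
  "b1 n m = {A. \<exists>t :: nat \<Rightarrow> real. A = mat n n (\<lambda>ab.
       \<Sum>i\<in>{1..m}. complex_of_real (t i) * (Eunit n i (n+1-i) - Eunit n (n+1-i) i) $$ ab)}"

definition b2 :: "nat \<Rightarrow> nat \<Rightarrow> complex mat set" where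
  "b2 n m = {A. \<exists>t :: nat \<Rightarrow> real. A = mat n n (\<lambda>ab.
       \<Sum>i\<in>{1..m}. complex_of_real (t i) * (Eunit n (i+1) (n+1-i) - Eunit n (n+1-i) (i+1)) $$ ab)}"

end

theory Submission
  imports Defs "Jordan_Normal_Form.Determinant"
begin

text \<open>Herringbone stitch, by induction on \<open>n\<close>. Unitary matrices of the blocks of \<open>H\<close> bring the
  first row of \<open>g\<close> into the form \<open>(cos \<theta>, 0, \<dots>, 0, sin \<theta>)\<close>, so \<open>g = (1 \<oplus> u) R h\<close> with \<open>R\<close> a
  rotation in the plane of the first and last coordinate. The matrix \<open>u\<close> matters only modulo
  \<open>U(n2) \<times> U(n3)\<close> on the left and, through the elements of \<open>H\<close> commuting with \<open>R\<close>, modulo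
  \<open>U(p-1) \<times> U(q-1) \<times> 1\<close> on the right. After inversion and reversal of the indices this is the same
  problem for \<open>n - 1 = 1 + (q-1) + (p-1) = n3 + n2\<close>, and it exchanges the roles of
  \<open>B'\<close> and \<open>B''\<close>.\<close>

section \<open>Unitary matrices\<close>

lemma mat_mult_entry:
  assumes "A \<in> carrier_mat n m" "B \<in> carrier_mat m r" "i < n" "j < r"
  shows "(A * B) $$ (i,j) = (\<Sum>k<m. A $$ (i,k) * B $$ (k,j))"
  using assms by (simp add: scalar_prod_def atLeast0LessThan)

lemma square_mult_carrier [simp]:
  "A \<in> carrier_mat n n \<Longrightarrow> B \<in> carrier_mat n n \<Longrightarrow> A * B \<in> carrier_mat n n"
  by simp

lemma square_mult_assoc:
  "A \<in> carrier_mat n n \<Longrightarrow> B \<in> carrier_mat n n \<Longrightarrow> C \<in> carrier_mat n n \<Longrightarrow> A * B * C = A * (B * C)"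
  by (rule assoc_mult_mat)

lemma ctrans_carrier [simp]: "A \<in> carrier_mat n m \<Longrightarrow> ctrans A \<in> carrier_mat m n"
  by (simp add: ctrans_def)

lemma ctrans_entry [simp]:
  "A \<in> carrier_mat n m \<Longrightarrow> i < m \<Longrightarrow> j < n \<Longrightarrow> ctrans A $$ (i,j) = cnj (A $$ (j,i))"
  by (auto simp: ctrans_def)

lemma ctrans_ctrans [simp]: "ctrans (ctrans A) = A"
  by (auto simp: ctrans_def)

lemma ctrans_mult:
  assumes A: "A \<in> carrier_mat n n" and B: "B \<in> carrier_mat n n"
  shows "ctrans (A * B) = ctrans B * ctrans A"
proof (rule eq_matI)
  fix i j assume "i < dim_row (ctrans B * ctrans A)" "j < dim_col (ctrans B * ctrans A)"
  with A B have ij: "i < n" "j < n" by (auto simp: ctrans_def)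
  have AB: "A * B \<in> carrier_mat n n" using A B by simp
  show "ctrans (A * B) $$ (i,j) = (ctrans B * ctrans A) $$ (i,j)"
    unfolding ctrans_entry[OF AB ij] mat_mult_entry[OF A B ij(2,1)]
      mat_mult_entry[OF ctrans_carrier[OF B] ctrans_carrier[OF A] ij]
    using A B ij by (simp add: mult.commute)
qed (use A B in \<open>auto simp: ctrans_def\<close>)

lemma unitary_grp_iff:
  "U \<in> unitary_grp n \<longleftrightarrow> U \<in> carrier_mat n n \<and>
     (\<forall>i<n. \<forall>j<n. (\<Sum>k<n. U $$ (i,k) * cnj (U $$ (j,k))) = (if i = j then 1 else 0))"
proof (cases "U \<in> carrier_mat n n")
  case U: True
  have e: "(U * ctrans U) $$ (i,j) = (\<Sum>k<n. U $$ (i,k) * cnj (U $$ (j,k)))" if "i < n" "j < n" for i j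
    unfolding mat_mult_entry[OF U ctrans_carrier[OF U] that] using U that by (intro sum.cong) auto
  have "U * ctrans U = 1\<^sub>m n \<longleftrightarrow> (\<forall>i<n. \<forall>j<n. (U * ctrans U) $$ (i,j) = (if i = j then 1 else 0))"
    using U carrier_matD[OF ctrans_carrier[OF U]] by (auto simp del: index_mult_mat(1) intro!: eq_matI)
  with U e show ?thesis by (simp add: unitary_grp_def del: index_mult_mat)
qed (simp add: unitary_grp_def)

lemma unitary_grp_carrier [intro]: "U \<in> unitary_grp n \<Longrightarrow> U \<in> carrier_mat n n"
  by (simp add: unitary_grp_def)

lemma unitary_mult_ctrans: "U \<in> unitary_grp n \<Longrightarrow> U * ctrans U = 1\<^sub>m n"
  by (simp add: unitary_grp_def)

text \<open>A one-sided inverse of a square matrix is two-sided, so orthonormal rows give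
  orthonormal columns.\<close>

lemma ctrans_mult_unitary: "U \<in> unitary_grp n \<Longrightarrow> ctrans U * U = 1\<^sub>m n"
  by (rule mat_mult_left_right_inverse) (auto simp: unitary_grp_def)

lemma one_unitary [simp]: "1\<^sub>m n \<in> unitary_grp n"
proof -
  have "ctrans (1\<^sub>m n) = 1\<^sub>m n" by (auto simp: ctrans_def)
  then show ?thesis by (simp add: unitary_grp_def)
qed

lemma unitary_ctrans [simp]: "U \<in> unitary_grp n \<Longrightarrow> ctrans U \<in> unitary_grp n"
  using ctrans_mult_unitary[of U n] by (simp add: unitary_grp_def)

lemma unitary_mult [simp]:
  assumes U: "U \<in> unitary_grp n" and V: "V \<in> unitary_grp n"
  shows "U * V \<in> unitary_grp n"
proof -
  have c: "U \<in> carrier_mat n n" "V \<in> carrier_mat n n" "ctrans U \<in> carrier_mat n n"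
    "ctrans V \<in> carrier_mat n n" using U V by auto
  have "(U * V) * ctrans (U * V) = (U * V) * (ctrans V * ctrans U)"
    using c by (simp add: ctrans_mult)
  also have "\<dots> = U * (V * (ctrans V * ctrans U))"
    using c by (simp add: square_mult_assoc[of _ n])
  also have "V * (ctrans V * ctrans U) = V * ctrans V * ctrans U"
    using c by (simp add: square_mult_assoc[of _ n])
  also have "U * \<dots> = 1\<^sub>m n"
    using c by (simp add: unitary_mult_ctrans[OF U] unitary_mult_ctrans[OF V] left_mult_one_mat[of _ n n])
  finally show ?thesis using c by (simp add: unitary_grp_def)
qed

section \<open>Block-diagonal subgroups and matrices acting on a set of coordinates\<close>

lemma block_unitary_one: "1\<^sub>m n \<in> block_unitary n blk"
  by (auto simp: block_unitary_def)

lemma block_unitary_mult: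
  assumes "U \<in> block_unitary n blk" "V \<in> block_unitary n blk"
  shows "U * V \<in> block_unitary n blk"
proof -
  have c: "U \<in> carrier_mat n n" "V \<in> carrier_mat n n"
    using assms by (auto simp: block_unitary_def)
  have "(U * V) $$ (i,j) = 0" if "i < n" "j < n" "blk i \<noteq> blk j" for i j
  proof -
    have "U $$ (i,k) * V $$ (k,j) = 0" if "k < n" for k
      using assms \<open>i < n\<close> \<open>j < n\<close> \<open>blk i \<noteq> blk j\<close> that
      by (cases "blk i = blk k") (auto simp: block_unitary_def)
    then show ?thesis unfolding mat_mult_entry[OF c \<open>i < n\<close> \<open>j < n\<close>] by (simp add: sum.neutral)
  qed
  with assms show ?thesis by (simp add: block_unitary_def del: index_mult_mat)
qed

lemma block_unitary_ctrans:
  assumes "U \<in> block_unitary n blk"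
  shows "ctrans U \<in> block_unitary n blk"
proof -
  have U: "U \<in> carrier_mat n n" using assms by (auto simp: block_unitary_def)
  show ?thesis using assms by (auto simp: block_unitary_def ctrans_entry[OF U])
qed

text \<open>Rows and columns are both prescribed, so \<open>A\<close> is the direct sum of the
  identity on the coordinates in \<open>S\<close> and a matrix on the others.\<close>

definition fixes_coords :: "nat \<Rightarrow> nat set \<Rightarrow> complex mat \<Rightarrow> bool" where
  "fixes_coords n S A \<longleftrightarrow>
     (\<forall>i<n. \<forall>j<n. i \<in> S \<or> j \<in> S \<longrightarrow> A $$ (i,j) = (if i = j then 1 else 0))"

text \<open>\<open>A\<close> acts only outside \<open>S\<close> and \<open>B\<close> only inside.
  Either product has the block of \<open>B\<close> on \<open>S\<close> and the block of
  \<open>A\<close> on the complement.\<close>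

lemma fixes_coords_commute:
  assumes A: "A \<in> carrier_mat n n" and B: "B \<in> carrier_mat n n"
    and fA: "fixes_coords n S A" and fB: "fixes_coords n (- S) B"
  shows "A * B = B * A"
proof (rule eq_matI)
  fix i j assume "i < dim_row (B * A)" "j < dim_col (B * A)"
  with A B have ij: "i < n" "j < n" by auto
  have A': "A $$ (k,l) = (if k = l then 1 else 0)" if "k < n" "l < n" "k \<in> S \<or> l \<in> S" for k l
    using fA that by (auto simp: fixes_coords_def)
  have B': "B $$ (k,l) = (if k = l then 1 else 0)" if "k < n" "l < n" "k \<notin> S \<or> l \<notin> S" for k l
    using fB that by (auto simp: fixes_coords_def)
  have "(\<Sum>k<n. A $$ (i,k) * B $$ (k,j)) = (if i \<in> S then B $$ (i,j) else A $$ (i,j))"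
  proof -
    have "A $$ (i,k) * B $$ (k,j) =
        (if k = (if i \<in> S then i else j) then if i \<in> S then B $$ (i,j) else A $$ (i,j) else 0)"
      if "k < n" for k
      using ij that A'[of i k] B'[of k j] by (cases "k \<in> S"; cases "i \<in> S"; cases "j \<in> S") auto
    then show ?thesis using ij by simp
  qed
  moreover have "(\<Sum>k<n. B $$ (i,k) * A $$ (k,j)) = (if i \<in> S then B $$ (i,j) else A $$ (i,j))"
  proof -
    have "B $$ (i,k) * A $$ (k,j) =
        (if k = (if i \<in> S then j else i) then if i \<in> S then B $$ (i,j) else A $$ (i,j) else 0)"
      if "k < n" for k
      using ij that B'[of i k] A'[of k j] by (cases "k \<in> S"; cases "i \<in> S"; cases "j \<in> S") auto
    then show ?thesis using ij by simp
  qed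
  ultimately show "(A * B) $$ (i,j) = (B * A) $$ (i,j)"
    by (simp add: mat_mult_entry[OF A B ij] mat_mult_entry[OF B A ij] del: index_mult_mat)
qed (use A B in auto)

lemma fixes_coords_ctrans:
  "A \<in> carrier_mat n n \<Longrightarrow> fixes_coords n S A \<Longrightarrow> fixes_coords n S (ctrans A)"
  by (auto simp: fixes_coords_def)

text \<open>A Householder reflection in the coordinates of \<open>S\<close>. It exists because the \<open>k\<close>-th
  coordinate of \<open>x\<close> is real; for \<open>v = 0\<close> the coefficient \<open>c\<close> is the junk value \<open>2 / 0 = 0\<close>.\<close>

lemma householder_real:
  fixes x :: "nat \<Rightarrow> complex"
  assumes S: "S \<subseteq> {..<n}" and k: "k \<in> S" and xk: "x k = of_real r"
  shows "\<exists>U \<in> unitary_grp n. fixes_coords n (- S) U \<and>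
    (\<forall>j\<in>S. (\<Sum>i<n. x i * U $$ (i,j)) =
        (if j = k then of_real (sqrt (\<Sum>i\<in>S. (cmod (x i))\<^sup>2)) else 0))"
proof -
  have fS: "finite S" using S finite_subset by blast
  define \<rho> where "\<rho> = sqrt (\<Sum>i\<in>S. (cmod (x i))\<^sup>2)"
  have \<rho>2: "complex_of_real (\<rho>\<^sup>2) = (\<Sum>i\<in>S. x i * cnj (x i))"
    by (simp add: \<rho>_def sum_nonneg flip: complex_norm_square)
  \<comment> \<open>On \<open>S\<close>, \<open>cnj v\<close> is the difference between
    \<open>x\<close> and the target, \<open>\<rho>\<close> times the \<open>k\<close>-th unit
    vector; the reflection along it sends the first to the second.\<close>
  define v where "v i = (if i \<in> S then cnj (x i) - (if i = k then of_real \<rho> else 0) else 0)" for i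
  define V where "V = (\<Sum>i<n. v i * cnj (v i))"
  define c where "c = 2 / V"
  define U where "U = mat n n (\<lambda>(i,j). (if i = j then 1 else 0) - c * v i * cnj (v j))"
  have Vsum: "V = of_real (\<Sum>i<n. (cmod (v i))\<^sup>2)"
    by (simp add: V_def flip: complex_norm_square)
  have cc: "cnj c = c" by (simp add: c_def Vsum)
  have cV: "c * (c * V) = 2 * c" by (simp add: c_def)
  have red: "(\<Sum>i<n. f i * v i) = (\<Sum>i\<in>S. f i * v i)" for f
    using S by (intro sum.mono_neutral_right) (auto simp: v_def)
  have xv: "(\<Sum>i<n. x i * v i) = of_real (\<rho>\<^sup>2 - \<rho> * r)"
  proof -
    have "(\<Sum>i<n. x i * v i) = (\<Sum>i\<in>S. x i * cnj (x i) - (if i = k then of_real (\<rho> * r) else 0))"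
      unfolding red by (intro sum.cong) (auto simp: v_def xk algebra_simps)
    then show ?thesis using fS k by (simp add: sum_subtractf flip: \<rho>2)
  qed
  \<comment> \<open>Twice the previous sum, because \<open>x k\<close> is real; for complex
    \<open>x k\<close> only the real parts would agree. Hence \<open>c * (V / 2)\<close> is
    \<open>1\<close> unless \<open>V = 0\<close>.\<close>
  have vv: "V = 2 * of_real (\<rho>\<^sup>2 - \<rho> * r)"
  proof -
    have "V = (\<Sum>i\<in>S. cnj (v i) * v i)" unfolding V_def
      by (subst red[symmetric]) (simp add: mult.commute)
    also have "\<dots> = (\<Sum>i\<in>S. x i * cnj (x i) + (if i = k then of_real (\<rho>\<^sup>2 - 2 * \<rho> * r) else 0))"
      by (intro sum.cong) (auto simp: v_def xk algebra_simps power2_eq_square)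
    finally show ?thesis using fS k by (simp add: sum.distrib \<rho>2[symmetric])
  qed
  have U: "U \<in> carrier_mat n n" by (simp add: U_def)
  have "U \<in> unitary_grp n" unfolding unitary_grp_iff
  proof (intro conjI allI impI U)
    fix i j assume ij: "i < n" "j < n"
    have "(\<Sum>l<n. U $$ (i,l) * cnj (U $$ (j,l))) =
       (\<Sum>l<n. (if l = i then (if i = j then 1 else 0) else 0)
          - (if l = i then c * v i * cnj (v j) else 0) - (if l = j then c * v i * cnj (v j) else 0)
          + c * c * v i * cnj (v j) * (v l * cnj (v l)))"
      using ij by (intro sum.cong) (auto simp: U_def cc algebra_simps)
    also have "\<dots> = (if i = j then 1 else 0) - 2 * c * v i * cnj (v j) + c * (c * V) * v i * cnj (v j)"
      using ij by (simp add: sum.distrib sum_subtractf V_def sum_distrib_left[symmetric])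
    finally show "(\<Sum>l<n. U $$ (i,l) * cnj (U $$ (j,l))) = (if i = j then 1 else 0)"
      by (simp add: cV)
  qed
  moreover have "fixes_coords n (- S) U"
    by (auto simp: fixes_coords_def U_def v_def)
  moreover have "(\<Sum>i<n. x i * U $$ (i,j)) = (if j = k then of_real \<rho> else 0)" if j: "j \<in> S" for j
  proof -
    have jn: "j < n" using j S by auto
    have "(\<Sum>i<n. x i * U $$ (i,j)) = (\<Sum>i<n. (if i = j then x j else 0) - c * cnj (v j) * (x i * v i))"
      using jn by (intro sum.cong) (auto simp: U_def algebra_simps)
    also have "\<dots> = x j - c * (V / 2) * cnj (v j)"
      using jn by (simp add: sum_subtractf sum_distrib_left[symmetric] xv vv)
    also have "\<dots> = x j - cnj (v j)"
    proof (cases "V = 0")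
      case True
      then have "(\<Sum>i<n. (cmod (v i))\<^sup>2) = 0" using Vsum by (metis of_real_eq_0_iff)
      then have "v j = 0" using jn by (simp add: sum_nonneg_eq_0_iff)
      then show ?thesis by simp
    qed (simp add: c_def)
    finally show ?thesis using j by (simp add: v_def)
  qed
  ultimately show ?thesis unfolding \<rho>_def by blast
qed

text \<open>A diagonal matrix of phases \<open>d\<close> first makes the \<open>k\<close>-th
  coordinate real without changing any modulus; \<open>W\<close> is its product with the Householder
  reflection.\<close>

lemma unitary_row_reduction:
  fixes x :: "nat \<Rightarrow> complex"
  assumes S: "S \<subseteq> {..<n}" and k: "k \<in> S"
  shows "\<exists>U \<in> unitary_grp n. fixes_coords n (- S) U \<and>
    (\<forall>j\<in>S. (\<Sum>i<n. x i * U $$ (i,j)) =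
        (if j = k then of_real (sqrt (\<Sum>i\<in>S. (cmod (x i))\<^sup>2)) else 0))"
proof -
  \<comment> \<open>For \<open>x k = 0\<close> the phase is set to \<open>1\<close>, since the
    quotient would be \<open>0\<close>, which is not of modulus one.\<close>
  define d :: "nat \<Rightarrow> complex" where
    "d i = (if i = k \<and> x k \<noteq> 0 then of_real (cmod (x k)) / x k else 1)" for i
  have nd: "cmod (d i) = 1" for i by (auto simp: d_def norm_divide)
  have dd: "d i * cnj (d i) = 1" for i
    using nd[of i] complex_norm_square[of "d i"] by simp
  have xk: "x k * d k = of_real (cmod (x k))" by (simp add: d_def)
  from householder_real[OF S k, of "\<lambda>i. x i * d i", OF xk]
  obtain U where U: "U \<in> unitary_grp n" "fixes_coords n (- S) U"
    and xU: "\<And>j. j \<in> S \<Longrightarrow> (\<Sum>i<n. x i * d i * U $$ (i,j)) =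
        (if j = k then of_real (sqrt (\<Sum>i\<in>S. (cmod (x i))\<^sup>2)) else 0)"
    by (auto simp: norm_mult nd)
  define W where "W = mat n n (\<lambda>(i,j). d i * U $$ (i,j))"
  have "W \<in> unitary_grp n" unfolding unitary_grp_iff
  proof (intro conjI allI impI)
    fix i j assume ij: "i < n" "j < n"
    have "(\<Sum>l<n. W $$ (i,l) * cnj (W $$ (j,l))) =
        d i * cnj (d j) * (\<Sum>l<n. U $$ (i,l) * cnj (U $$ (j,l)))"
      using ij by (simp add: W_def sum_distrib_left mult.assoc mult.left_commute)
    also have "\<dots> = (if i = j then 1 else 0)"
      using U(1) ij dd by (auto simp: unitary_grp_iff)
    finally show "(\<Sum>l<n. W $$ (i,l) * cnj (W $$ (j,l))) = (if i = j then 1 else 0)" .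
  qed (simp add: W_def)
  moreover have "fixes_coords n (- S) W"
    using U(2) k by (auto simp: fixes_coords_def W_def d_def)
  moreover have "(\<Sum>i<n. x i * W $$ (i,j)) = (\<Sum>i<n. x i * d i * U $$ (i,j))" if "j \<in> S" for j
    using that S by (intro sum.cong) (auto simp: W_def mult.assoc)
  ultimately show ?thesis using xU by auto
qed

section \<open>Rotations in pairwise orthogonal coordinate planes\<close>

text \<open>The involution \<open>s\<close> pairs the coordinates; a coordinate fixed by \<open>s\<close> has angle \<open>0\<close>,
  so that the two summands below do not interfere on the diagonal.\<close>

definition rotation :: "nat \<Rightarrow> (nat \<Rightarrow> nat) \<Rightarrow> (nat \<Rightarrow> real) \<Rightarrow> complex mat" where
  "rotation n s t = mat n n (\<lambda>(i,j).
     (if j = i then of_real (cos (t i)) else 0) + (if j = s i then of_real (sin (t i)) else 0))"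

definition skew_pairing :: "nat \<Rightarrow> (nat \<Rightarrow> nat) \<Rightarrow> (nat \<Rightarrow> real) \<Rightarrow> complex mat" where
  "skew_pairing n s t = mat n n (\<lambda>(i,j). if j = s i then of_real (t i) else 0)"

definition paired_angles :: "nat \<Rightarrow> (nat \<Rightarrow> nat) \<Rightarrow> (nat \<Rightarrow> real) \<Rightarrow> bool" where
  "paired_angles n s t \<longleftrightarrow> (\<forall>i<n. s i < n \<and> s (s i) = i \<and> t (s i) = - t i)"

lemma rotation_carrier [simp]: "rotation n s t \<in> carrier_mat n n"
  by (simp add: rotation_def)

text \<open>For rows with at most two nonzero entries. The coefficients add when
  \<open>i = j\<close>, which covers coordinates fixed by the pairing.\<close>

lemma sum_two_deltas:
  fixes f :: "nat \<Rightarrow> complex"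
  assumes "i < n" "j < n"
  shows "(\<Sum>k<n. ((if k = i then a else 0) + (if k = j then b else 0)) * f k) = a * f i + b * f j"
proof -
  have "(\<Sum>k<n. ((if k = i then a else 0) + (if k = j then b else 0)) * f k) =
      (\<Sum>k<n. (if k = i then a * f i else 0) + (if k = j then b * f j else 0))"
    by (intro sum.cong) (auto simp: algebra_simps)
  then show ?thesis using assms by (simp add: sum.distrib)
qed

text \<open>Row \<open>i\<close> of every power is supported at \<open>i\<close> and
  \<open>s i\<close>, and the power series of these two entries are those of cosine and
  sine.\<close>

lemma mexp_skew_pairing:
  assumes st: "paired_angles n s t"
  shows "mexp (skew_pairing n s t) = rotation n s t"
proof (rule eq_matI)
  let ?A = "skew_pairing n s t"
  have A: "?A \<in> carrier_mat n n" by (simp add: skew_pairing_def)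
  fix i j assume "i < dim_row (rotation n s t)" "j < dim_col (rotation n s t)"
  then have i: "i < n" and j: "j < n" by (auto simp: rotation_def)
  have s: "s i < n" "s (s i) = i" "t (s i) = - t i" using st i by (auto simp: paired_angles_def)
  have s0: "s i = i \<Longrightarrow> t i = 0" using s(3) by auto
  \<comment> \<open>With \<open>t\<close> for \<open>t i\<close>, these are the sequences
    \<open>1, 0, -t^2, 0, ...\<close> and \<open>0, t, 0, -t^3, ...\<close>; \<open>fact k\<close>
    cancels the Taylor denominators.\<close>
  define a where "a k = complex_of_real (fact k * cos_coeff k * t i ^ k)" for k
  define b where "b k = complex_of_real (fact k * sin_coeff k * t i ^ k)" for k
  have aS: "a (Suc k) = - (b k * t i)" and bS: "b (Suc k) = a k * t i" for k
    by (simp_all add: a_def b_def cos_coeff_Suc sin_coeff_Suc field_simps del: of_nat_Suc)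
  have pow: "(?A ^\<^sub>m k) $$ (i,l) = (if l = i then a k else 0) + (if l = s i then b k else 0)"
    if "l < n" for k l
    using that
  proof (induction k arbitrary: l)
    case 0
    then show ?case using i A by (auto simp: a_def b_def cos_coeff_def sin_coeff_def)
  next
    case (Suc k)
    have "(?A ^\<^sub>m Suc k) $$ (i,l) = (\<Sum>m<n. (?A ^\<^sub>m k) $$ (i,m) * ?A $$ (m,l))"
      using mat_mult_entry[OF pow_carrier_mat[OF A] A i \<open>l < n\<close>] by simp
    also have "\<dots> = (\<Sum>m<n. ((if m = i then a k else 0) + (if m = s i then b k else 0)) * ?A $$ (m,l))"
      using Suc.IH by (intro sum.cong) auto
    also have "\<dots> = a k * ?A $$ (i,l) + b k * ?A $$ (s i,l)"
      by (rule sum_two_deltas[OF i s(1)])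
    \<comment> \<open>Multiplying by \<open>?A\<close> exchanges the two positions; the sign in
      \<open>t (s i) = - t i\<close> yields the recursion for \<open>a\<close>.\<close>
    also have "\<dots> = (if l = i then a (Suc k) else 0) + (if l = s i then b (Suc k) else 0)"
      using i s s0 Suc.prems by (auto simp: skew_pairing_def aS bS)
    finally show ?case .
  qed
  have "(\<lambda>k. complex_of_real (cos_coeff k * t i ^ k)) sums of_real (cos (t i))"
    using cos_converges[of "t i"] by (intro sums_of_real) simp
  moreover have "(\<lambda>k. complex_of_real (sin_coeff k * t i ^ k)) sums of_real (sin (t i))"
    using sin_converges[of "t i"] by (intro sums_of_real) simp
  ultimately have "(\<lambda>k. (if j = i then complex_of_real (cos_coeff k * t i ^ k) else 0)
      + (if j = s i then complex_of_real (sin_coeff k * t i ^ k) else 0)) sums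
      ((if j = i then of_real (cos (t i)) else 0) + (if j = s i then of_real (sin (t i)) else 0))"
    by (intro sums_add) auto
  moreover have "(?A ^\<^sub>m k) $$ (i,j) / of_nat (fact k) =
     (if j = i then complex_of_real (cos_coeff k * t i ^ k) else 0)
      + (if j = s i then complex_of_real (sin_coeff k * t i ^ k) else 0)" for k
    unfolding pow[OF j] by (simp add: a_def b_def add_divide_distrib)
  ultimately have "(\<Sum>k. (?A ^\<^sub>m k) $$ (i,j) / of_nat (fact k)) = rotation n s t $$ (i,j)"
    using i j by (simp add: rotation_def sums_iff)
  then show "mexp ?A $$ (i,j) = rotation n s t $$ (i,j)"
    using i j A by (simp add: mexp_def)
qed (auto simp: mexp_def skew_pairing_def rotation_def)

text \<open>The addition theorems in all planes at once: rotations with the same pairing merge into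
  one.\<close>

lemma rotation_mult:
  assumes t: "paired_angles n s t" and u: "paired_angles n s u"
  shows "rotation n s t * rotation n s u = rotation n s (\<lambda>i. t i + u i)"
proof (rule eq_matI)
  fix i j assume "i < dim_row (rotation n s (\<lambda>i. t i + u i))" "j < dim_col (rotation n s (\<lambda>i. t i + u i))"
  then have ij: "i < n" "j < n" by (auto simp: rotation_def)
  have s: "s i < n" "s (s i) = i" "t (s i) = - t i" "u (s i) = - u i"
    using t u ij by (auto simp: paired_angles_def)
  have "(rotation n s t * rotation n s u) $$ (i,j) =
     (\<Sum>k<n. ((if k = i then of_real (cos (t i)) else 0) + (if k = s i then of_real (sin (t i)) else 0))
        * rotation n s u $$ (k,j))"
    unfolding mat_mult_entry[OF rotation_carrier rotation_carrier ij]
    using ij by (intro sum.cong) (auto simp: rotation_def)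
  also have "\<dots> = of_real (cos (t i)) * rotation n s u $$ (i,j) + of_real (sin (t i)) * rotation n s u $$ (s i,j)"
    by (rule sum_two_deltas[OF ij(1) s(1)])
  also have "\<dots> = rotation n s (\<lambda>i. t i + u i) $$ (i,j)"
    using ij s by (auto simp: rotation_def cos_add sin_add algebra_simps)
  finally show "(rotation n s t * rotation n s u) $$ (i,j) = rotation n s (\<lambda>i. t i + u i) $$ (i,j)" .
qed (auto simp: rotation_def)

lemma ctrans_rotation:
  assumes t: "paired_angles n s t"
  shows "ctrans (rotation n s t) = rotation n s (\<lambda>i. - t i)"
proof (rule eq_matI)
  fix i j assume "i < dim_row (rotation n s (\<lambda>i. - t i))" "j < dim_col (rotation n s (\<lambda>i. - t i))"
  then have ij: "i < n" "j < n" by (auto simp: rotation_def)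
  have si: "s (s i) = i" "s (s j) = j" "t (s i) = - t i"
    using t ij by (auto simp: paired_angles_def)
  show "ctrans (rotation n s t) $$ (i,j) = rotation n s (\<lambda>i. - t i) $$ (i,j)"
  proof (cases "j = s i")
    case True
    then show ?thesis unfolding ctrans_entry[OF rotation_carrier ij] using ij si
      by (simp add: rotation_def)
  next
    case False
    then have "i \<noteq> s j" using si by metis
    then show ?thesis unfolding ctrans_entry[OF rotation_carrier ij] using ij False
      by (simp add: rotation_def)
  qed
qed (auto simp: rotation_def ctrans_def)

lemma paired_angles_uminus: "paired_angles n s t \<Longrightarrow> paired_angles n s (\<lambda>i. - t i)"
  by (auto simp: paired_angles_def)

lemma rotation_unitary:
  assumes t: "paired_angles n s t"
  shows "rotation n s t \<in> unitary_grp n"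
proof -
  have "rotation n s (\<lambda>i. 0) = 1\<^sub>m n" by (auto simp: rotation_def)
  then show ?thesis
    using rotation_mult[OF t paired_angles_uminus[OF t]]
    by (simp add: unitary_grp_def ctrans_rotation[OF t])
qed

section \<open>The toral subgroups as families of rotations\<close>

definition flip_pair :: "nat \<Rightarrow> nat \<Rightarrow> nat" where
  "flip_pair n i = n - 1 - i"

text \<open>In 0-based indices, \<open>flip_pair\<close> matches the positions \<open>i\<close> and
  \<open>n + 1 - i\<close> of \<open>b1\<close>, and \<open>shift_pair\<close> the positions
  \<open>i + 1\<close> and \<open>n + 1 - i\<close> of \<open>b2\<close>, where the first coordinate
  has no partner.\<close>

definition shift_pair :: "nat \<Rightarrow> nat \<Rightarrow> nat" where
  "shift_pair n i = (if i = 0 then 0 else n - i)"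

text \<open>The angles vanish outside the first \<open>m\<close> and the last \<open>m\<close>
  coordinates, so at most \<open>m\<close> planes rotate.\<close>

definition flip_rotations :: "nat \<Rightarrow> nat \<Rightarrow> complex mat set" where
  "flip_rotations n m = {rotation n (flip_pair n) t | t.
     paired_angles n (flip_pair n) t \<and> (\<forall>i. m \<le> i \<and> i + m < n \<longrightarrow> t i = 0)}"

definition shift_rotations :: "nat \<Rightarrow> nat \<Rightarrow> complex mat set" where
  "shift_rotations n m = {rotation n (shift_pair n) t | t.
     paired_angles n (shift_pair n) t \<and> (\<forall>i. m < i \<and> i + m < n \<longrightarrow> t i = 0)}"

lemma Eunit_diff_entry:
  "a < n \<Longrightarrow> b < n \<Longrightarrow> (Eunit n i j - Eunit n j i) $$ (a,b) =
     (if a = i - 1 \<and> b = j - 1 then 1 else 0) - (if a = j - 1 \<and> b = i - 1 then 1 else 0)"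
  by (simp add: Eunit_def)

lemma exp_b1:
  assumes m: "2 * m \<le> n"
  shows "mexp ` b1 n m = flip_rotations n m"
\<comment> \<open>The bound \<open>2 * m \<le> n\<close> keeps the first \<open>m\<close> and the
  last \<open>m\<close> coordinates apart, so distinct generators act in disjoint planes and the
  exponential is computed plane by plane.\<close>
proof -
  let ?E = "\<lambda>i. Eunit n i (n+1-i) - Eunit n (n+1-i) i"
  let ?s = "flip_pair n"
  \<comment> \<open>Generator \<open>i\<close> has its \<open>+1\<close> in row \<open>i - 1\<close>
    and its \<open>-1\<close> in row \<open>n - i\<close>, counted from \<open>0\<close>.\<close>
  define \<tau> where "\<tau> u a = (if a < m then u (a + 1) else if n - 1 - a < m then - u (n - a) else 0)"
    for u :: "nat \<Rightarrow> real" and a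
  have gen: "mat n n (\<lambda>ab. \<Sum>i\<in>{1..m}. complex_of_real (u i) * ?E i $$ ab) = skew_pairing n ?s (\<tau> u)"
    for u :: "nat \<Rightarrow> real"
  proof (rule eq_matI)
    fix a b assume "a < dim_row (skew_pairing n ?s (\<tau> u))" "b < dim_col (skew_pairing n ?s (\<tau> u))"
    then have ab: "a < n" "b < n" by (auto simp: skew_pairing_def)
    have "(\<Sum>i\<in>{1..m}. complex_of_real (u i) * ?E i $$ (a,b))
      = (\<Sum>i\<in>{1..m}. (if i = a + 1 then (if b = n - 1 - a then of_real (u i) else 0) else 0)
          + (if i = n - a then (if b = n - 1 - a then - of_real (u i) else 0) else 0))"
    proof (intro sum.cong refl)
      fix i assume "i \<in> {1..m}"
      then have i: "1 \<le> i" "i \<le> m" by auto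
      have eqs: "a = i - 1 \<and> b = n + 1 - i - 1 \<longleftrightarrow> i = a + 1 \<and> b = n - 1 - a"
        "a = n + 1 - i - 1 \<and> b = i - 1 \<longleftrightarrow> i = n - a \<and> b = n - 1 - a"
        using i ab m by (intro iffI; elim conjE; intro conjI; linarith)+
      show "complex_of_real (u i) * ?E i $$ (a,b) =
          (if i = a + 1 then (if b = n - 1 - a then of_real (u i) else 0) else 0)
          + (if i = n - a then (if b = n - 1 - a then - of_real (u i) else 0) else 0)"
        unfolding Eunit_diff_entry[OF ab] eqs by simp
    qed
    also have "\<dots> = (if a + 1 \<in> {1..m} \<and> b = n - 1 - a then of_real (u (a + 1)) else 0)
        - (if n - a \<in> {1..m} \<and> b = n - 1 - a then of_real (u (n - a)) else 0)"
      by (simp add: sum.distrib)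
    also have "\<dots> = skew_pairing n ?s (\<tau> u) $$ (a,b)"
      using ab m by (auto simp: skew_pairing_def \<tau>_def flip_pair_def)
    finally show "mat n n (\<lambda>ab. \<Sum>i\<in>{1..m}. complex_of_real (u i) * ?E i $$ ab) $$ (a,b)
      = skew_pairing n ?s (\<tau> u) $$ (a,b)"
      using ab by simp
  qed (auto simp: skew_pairing_def)
  have pa: "paired_angles n ?s (\<tau> u)" for u
    using m by (auto simp: paired_angles_def \<tau>_def flip_pair_def Suc_diff_Suc)
  show ?thesis
  proof (intro equalityI subsetI)
    fix M assume "M \<in> mexp ` b1 n m"
    then obtain u :: "nat \<Rightarrow> real" where "M = mexp (skew_pairing n ?s (\<tau> u))"
      unfolding b1_def gen by blast
    then show "M \<in> flip_rotations n m"
      unfolding mexp_skew_pairing[OF pa] flip_rotations_def using pa[of u]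
      by (intro CollectI exI[of _ "\<tau> u"] conjI) (auto simp: \<tau>_def flip_pair_def)
  next
    fix M assume "M \<in> flip_rotations n m"
    then obtain t where t: "M = rotation n ?s t" "paired_angles n ?s t"
      "\<And>i. m \<le> i \<Longrightarrow> i + m < n \<Longrightarrow> t i = 0" by (auto simp: flip_rotations_def)
    \<comment> \<open>The angles of the first \<open>m\<close> coordinates are the parameters;
      antisymmetry determines the others.\<close>
    define u where "u i = t (i - 1)" for i
    have "t a = \<tau> u a" if a: "a < n" for a
    proof -
      have "t (?s a) = - t a" using t(2) a by (simp add: paired_angles_def)
      then show ?thesis using t(3)[of a] a by (auto simp: u_def \<tau>_def flip_pair_def split: if_splits)
    qed
    then have "skew_pairing n ?s t = skew_pairing n ?s (\<tau> u)"
      by (auto simp: skew_pairing_def)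
    also have "\<dots> \<in> b1 n m" unfolding b1_def gen by blast
    finally show "M \<in> mexp ` b1 n m" using mexp_skew_pairing[OF t(2)] t(1) by (metis imageI)
  qed
qed

text \<open>The same argument without coordinate \<open>0\<close>. Generator \<open>i\<close>
  occupies the 0-based rows \<open>i\<close> and \<open>n - i\<close>, so parameters need no shift;
  the strict bound separates \<open>1\<close> to \<open>m\<close> from the last \<open>m\<close>
  coordinates.\<close>

lemma exp_b2:
  assumes m: "2 * m < n"
  shows "mexp ` b2 n m = shift_rotations n m"
proof -
  let ?E = "\<lambda>i. Eunit n (i+1) (n+1-i) - Eunit n (n+1-i) (i+1)"
  let ?s = "shift_pair n"
  define \<tau> where "\<tau> u a = (if a = 0 then 0 else if a \<le> m then u a else if n - a \<le> m then - u (n - a) else 0)"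
    for u :: "nat \<Rightarrow> real" and a
  have gen: "mat n n (\<lambda>ab. \<Sum>i\<in>{1..m}. complex_of_real (u i) * ?E i $$ ab) = skew_pairing n ?s (\<tau> u)"
    for u :: "nat \<Rightarrow> real"
  proof (rule eq_matI)
    fix a b assume "a < dim_row (skew_pairing n ?s (\<tau> u))" "b < dim_col (skew_pairing n ?s (\<tau> u))"
    then have ab: "a < n" "b < n" by (auto simp: skew_pairing_def)
    have "(\<Sum>i\<in>{1..m}. complex_of_real (u i) * ?E i $$ (a,b))
      = (\<Sum>i\<in>{1..m}. (if i = a then (if b = n - a then of_real (u i) else 0) else 0)
          + (if i = n - a then (if b = n - a then - of_real (u i) else 0) else 0))"
    proof (intro sum.cong refl)
      fix i assume "i \<in> {1..m}"
      then have i: "1 \<le> i" "i \<le> m" by auto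
      have eqs: "a = i + 1 - 1 \<and> b = n + 1 - i - 1 \<longleftrightarrow> i = a \<and> b = n - a"
        "a = n + 1 - i - 1 \<and> b = i + 1 - 1 \<longleftrightarrow> i = n - a \<and> b = n - a"
        using i ab m by (intro iffI; elim conjE; intro conjI; linarith)+
      show "complex_of_real (u i) * ?E i $$ (a,b) =
          (if i = a then (if b = n - a then of_real (u i) else 0) else 0)
          + (if i = n - a then (if b = n - a then - of_real (u i) else 0) else 0)"
        unfolding Eunit_diff_entry[OF ab] eqs by simp
    qed
    also have "\<dots> = (if a \<in> {1..m} \<and> b = n - a then of_real (u (a)) else 0)
        - (if n - a \<in> {1..m} \<and> b = n - a then of_real (u (n - a)) else 0)"
      by (simp add: sum.distrib)
    also have "\<dots> = skew_pairing n ?s (\<tau> u) $$ (a,b)"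
      using ab m by (auto simp: skew_pairing_def \<tau>_def shift_pair_def)
    finally show "mat n n (\<lambda>ab. \<Sum>i\<in>{1..m}. complex_of_real (u i) * ?E i $$ ab) $$ (a,b)
      = skew_pairing n ?s (\<tau> u) $$ (a,b)"
      using ab by simp
  qed (auto simp: skew_pairing_def)
  have pa: "paired_angles n ?s (\<tau> u)" for u
    using m by (auto simp: paired_angles_def \<tau>_def shift_pair_def)
  show ?thesis
  proof (intro equalityI subsetI)
    fix M assume "M \<in> mexp ` b2 n m"
    then obtain u :: "nat \<Rightarrow> real" where "M = mexp (skew_pairing n ?s (\<tau> u))"
      unfolding b2_def gen by blast
    then show "M \<in> shift_rotations n m"
      unfolding mexp_skew_pairing[OF pa] shift_rotations_def using pa[of u]
      by (intro CollectI exI[of _ "\<tau> u"] conjI) (auto simp: \<tau>_def)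
  next
    fix M assume "M \<in> shift_rotations n m"
    then obtain t where t: "M = rotation n ?s t" "paired_angles n ?s t"
      "\<And>i. m < i \<Longrightarrow> i + m < n \<Longrightarrow> t i = 0" by (auto simp: shift_rotations_def)
    have "t a = \<tau> t a" if a: "a < n" for a
    proof -
      have e: "t (?s a) = - t a" using t(2) a by (simp add: paired_angles_def)
      consider "a = 0" | "0 < a" "a \<le> m" | "m < a" "n - a \<le> m" | "m < a" "a + m < n" by linarith
      then show ?thesis
      proof cases
        case 1 then show ?thesis using e by (simp add: \<tau>_def shift_pair_def)
      next
        case 2 then show ?thesis by (simp add: \<tau>_def)
      next
        case 3 then show ?thesis using e by (simp add: \<tau>_def shift_pair_def)
      next
        case 4 then show ?thesis using t(3)[of a] by (auto simp: \<tau>_def)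
      qed
    qed
    then have "skew_pairing n ?s t = skew_pairing n ?s (\<tau> t)"
      by (auto simp: skew_pairing_def)
    also have "\<dots> \<in> b2 n m" unfolding b2_def gen by blast
    finally show "M \<in> mexp ` b2 n m" using mexp_skew_pairing[OF t(2)] t(1) by (metis imageI)
  qed
qed

section \<open>The herringbone induction\<close>

text \<open>The indices are reversed so that the smaller double coset problem, in which the roles of
  the two subgroups are exchanged, is again in standard position.\<close>

definition reverse_embed :: "nat \<Rightarrow> complex mat \<Rightarrow> complex mat" where
  "reverse_embed N u = mat (Suc N) (Suc N)
     (\<lambda>(a,b). if a = 0 \<or> b = 0 then if a = b then 1 else 0 else u $$ (N - a, N - b))"

lemma reverse_embed_carrier [simp]: "reverse_embed N u \<in> carrier_mat (Suc N) (Suc N)"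
  by (simp add: reverse_embed_def)

lemma reverse_embed_entry:
  "a < Suc N \<Longrightarrow> b < Suc N \<Longrightarrow> reverse_embed N u $$ (a,b) =
     (if a = 0 \<or> b = 0 then if a = b then 1 else 0 else u $$ (N - a, N - b))"
  by (simp add: reverse_embed_def)

lemma reverse_embed_one: "reverse_embed N (1\<^sub>m N) = 1\<^sub>m (Suc N)"
  by (rule eq_matI) (auto simp: reverse_embed_def)

lemma reverse_embed_mult:
  assumes u: "u \<in> carrier_mat N N" and v: "v \<in> carrier_mat N N"
  shows "reverse_embed N (u * v) = reverse_embed N u * reverse_embed N v"
proof (rule eq_matI)
  let ?E = "reverse_embed N"
  fix a b assume "a < dim_row (?E u * ?E v)" "b < dim_col (?E u * ?E v)"
  then have ab: "a < Suc N" "b < Suc N" by (auto simp: reverse_embed_def)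
  have E: "(?E u * ?E v) $$ (a,b) = ?E u $$ (a,0) * ?E v $$ (0,b) +
      (\<Sum>k<N. ?E u $$ (a,Suc k) * ?E v $$ (Suc k,b))"
    unfolding mat_mult_entry[OF reverse_embed_carrier reverse_embed_carrier ab]
    by (rule sum.lessThan_Suc_shift)
  show "?E (u * v) $$ (a,b) = (?E u * ?E v) $$ (a,b)"
  proof (cases "a = 0 \<or> b = 0")
    case True
    then have "(\<Sum>k<N. ?E u $$ (a,Suc k) * ?E v $$ (Suc k,b)) = 0"
      using ab by (intro sum.neutral) (auto simp: reverse_embed_entry)
    with True show ?thesis unfolding E using ab by (auto simp: reverse_embed_entry)
  next
    case False
    have "(\<Sum>k<N. ?E u $$ (a,Suc k) * ?E v $$ (Suc k,b)) =
        (\<Sum>k<N. u $$ (N - a,N - Suc k) * v $$ (N - Suc k,N - b))"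
      using ab False by (intro sum.cong) (auto simp: reverse_embed_entry)
    also have "\<dots> = (\<Sum>k<N. u $$ (N - a,k) * v $$ (k,N - b))"
      by (rule sum.nat_diff_reindex)
    also have "\<dots> = (u * v) $$ (N - a, N - b)"
      using ab False by (intro mat_mult_entry[OF u v, symmetric]) auto
    finally show ?thesis unfolding E using ab False by (simp add: reverse_embed_entry del: index_mult_mat)
  qed
qed (auto simp: reverse_embed_def)

lemma ctrans_reverse_embed:
  assumes u: "u \<in> carrier_mat N N"
  shows "ctrans (reverse_embed N u) = reverse_embed N (ctrans u)"
proof (rule eq_matI)
  fix a b assume "a < dim_row (reverse_embed N (ctrans u))" "b < dim_col (reverse_embed N (ctrans u))"
  then have ab: "a < Suc N" "b < Suc N" by (auto simp: reverse_embed_def)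
  show "ctrans (reverse_embed N u) $$ (a,b) = reverse_embed N (ctrans u) $$ (a,b)"
    unfolding ctrans_entry[OF reverse_embed_carrier ab] reverse_embed_entry[OF ab]
      reverse_embed_entry[OF ab(2,1)]
    using ab ctrans_entry[OF u, of "N - a" "N - b"] by auto
qed (auto simp: reverse_embed_def ctrans_def)

lemma reverse_embed_unitary:
  assumes u: "u \<in> unitary_grp N"
  shows "reverse_embed N u \<in> unitary_grp (Suc N)"
proof -
  have "u \<in> carrier_mat N N" using u by auto
  then have "reverse_embed N u * ctrans (reverse_embed N u) = reverse_embed N (u * ctrans u)"
    by (simp add: ctrans_reverse_embed reverse_embed_mult)
  then show ?thesis by (simp add: unitary_grp_def unitary_mult_ctrans[OF u] reverse_embed_one)
qed

lemma reverse_embed_inject: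
  assumes u: "u \<in> carrier_mat N N" and v: "v \<in> carrier_mat N N"
    and eq: "reverse_embed N u = reverse_embed N v"
  shows "u = v"
proof (rule eq_matI)
  fix i j assume "i < dim_row v" "j < dim_col v"
  then have ij: "i < N" "j < N" using v by auto
  have "reverse_embed N u $$ (N - i, N - j) = reverse_embed N v $$ (N - i, N - j)" by (simp add: eq)
  then show "u $$ (i,j) = v $$ (i,j)" using ij by (simp add: reverse_embed_entry)
qed (use u v in auto)

text \<open>Orthogonality of the later rows to the first one forces the first column to be a unit
  vector too. Injectivity of the embedding then makes the remaining block unitary.\<close>

lemma unitary_first_row_unit:
  assumes g: "g \<in> unitary_grp (Suc N)"
    and row: "\<And>j. j < Suc N \<Longrightarrow> g $$ (0,j) = (if j = 0 then 1 else 0)"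
  shows "\<exists>u \<in> unitary_grp N. g = reverse_embed N u"
proof -
  have gc: "g \<in> carrier_mat (Suc N) (Suc N)" using g by auto
  have col: "g $$ (i,0) = (if i = 0 then 1 else 0)" if "i < Suc N" for i
  proof -
    have "(\<Sum>k<Suc N. g $$ (i,k) * cnj (g $$ (0,k))) = (\<Sum>k<Suc N. if k = 0 then g $$ (i,0) else 0)"
      using row by (intro sum.cong) auto
    also have "\<dots> = g $$ (i,0)" by (simp del: sum.lessThan_Suc)
    finally have "g $$ (i,0) = (\<Sum>k<Suc N. g $$ (i,k) * cnj (g $$ (0,k)))" ..
    also have "\<dots> = (if i = 0 then 1 else 0)" using g that unfolding unitary_grp_iff by blast
    finally show ?thesis .
  qed
  define u where "u = mat N N (\<lambda>(i,j). g $$ (N - i, N - j))"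
  have uc: "u \<in> carrier_mat N N" by (simp add: u_def)
  have gu: "g = reverse_embed N u"
  proof (rule eq_matI)
    fix i j assume "i < dim_row (reverse_embed N u)" "j < dim_col (reverse_embed N u)"
    then show "g $$ (i,j) = reverse_embed N u $$ (i,j)"
      using row[of j] col[of i] by (auto simp: reverse_embed_def u_def)
  qed (use gc in \<open>auto simp: reverse_embed_def\<close>)
  have "reverse_embed N (u * ctrans u) = reverse_embed N (1\<^sub>m N)"
    using unitary_mult_ctrans[OF g] uc
    by (simp add: gu reverse_embed_mult ctrans_reverse_embed reverse_embed_one)
  from reverse_embed_inject[OF _ _ this] have "u * ctrans u = 1\<^sub>m N" using uc by simp
  with uc gu show ?thesis by (auto simp: unitary_grp_def)
qed

text \<open>The pairings need to match only where the angle is nonzero, because a zero angle removes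
  the sine term. This matters for the fixed coordinate of \<open>shift_pair\<close>, which
  \<open>flip_pair\<close> will match with the new coordinate.\<close>

lemma reverse_embed_rotation:
  assumes s: "\<And>a. a < N \<Longrightarrow> s a < N"
    and t0: "t' 0 = 0" and t: "\<And>a. 0 < a \<Longrightarrow> a \<le> N \<Longrightarrow> t' a = t (N - a)"
    and s': "\<And>a. 0 < a \<Longrightarrow> a \<le> N \<Longrightarrow> t (N - a) \<noteq> 0 \<Longrightarrow> s' a = N - s (N - a)"
  shows "reverse_embed N (rotation N s t) = rotation (Suc N) s' t'"
proof (rule eq_matI)
  fix a b assume "a < dim_row (rotation (Suc N) s' t')" "b < dim_col (rotation (Suc N) s' t')"
  then have ab: "a \<le> N" "b \<le> N" by (auto simp: rotation_def)
  show "reverse_embed N (rotation N s t) $$ (a,b) = rotation (Suc N) s' t' $$ (a,b)"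
  proof (cases "a = 0")
    case True
    then show ?thesis using ab t0 by (auto simp: reverse_embed_entry rotation_def)
  next
    case False
    show ?thesis
    proof (cases "t (N - a) = 0")
      case True
      then show ?thesis using False ab t[of a] by (auto simp: reverse_embed_entry rotation_def)
    next
      case nz: False
      have "s (N - a) < N" using s[of "N - a"] False ab by simp
      then have "N - b = s (N - a) \<longleftrightarrow> b = N - s (N - a)" "N - b = N - a \<longleftrightarrow> b = a" "N - s (N - a) \<noteq> 0"
        using ab by auto
      then show ?thesis using False ab t[of a] s'[OF _ ab(1) nz]
        by (cases "b = 0") (simp_all add: reverse_embed_entry rotation_def)
    qed
  qed
qed (auto simp: reverse_embed_def rotation_def)

lemma shift_rotations_ctrans:
  assumes "z \<in> shift_rotations n m"
  shows "ctrans z \<in> shift_rotations n m"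
proof -
  obtain t where t: "z = rotation n (shift_pair n) t" "paired_angles n (shift_pair n) t"
    "\<forall>i. m < i \<and> i + m < n \<longrightarrow> t i = 0"
    using assms unfolding shift_rotations_def by blast
  show ?thesis
    unfolding shift_rotations_def t(1) ctrans_rotation[OF t(2)]
    using paired_angles_uminus[OF t(2)] t(3) by (intro CollectI exI[of _ "\<lambda>i. - t i"]) auto
qed

lemma flip_rotations_unitary: "z \<in> flip_rotations n m \<Longrightarrow> z \<in> unitary_grp n"
  by (auto simp: flip_rotations_def rotation_unitary)

lemma shift_rotations_unitary: "z \<in> shift_rotations n m \<Longrightarrow> z \<in> unitary_grp n"
  by (auto simp: shift_rotations_def rotation_unitary)

lemma flip_rotations_one: "1\<^sub>m n \<in> flip_rotations n m"
  unfolding flip_rotations_def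
  by (intro CollectI exI[of _ "\<lambda>_. 0"]) (auto simp: rotation_def paired_angles_def flip_pair_def)

lemma shift_rotations_one: "1\<^sub>m n \<in> shift_rotations n m"
  unfolding shift_rotations_def
  by (intro CollectI exI[of _ "\<lambda>_. 0"]) (auto simp: rotation_def paired_angles_def shift_pair_def)

text \<open>Index \<open>i\<close> moves to \<open>a = N - i\<close> and its partner
  \<open>N - 1 - i\<close> to \<open>Suc N - a\<close>: a \<open>B'\<close> factor of the smaller
  problem becomes a \<open>B''\<close> factor of the larger one.\<close>

lemma reverse_embed_flip:
  assumes "z \<in> flip_rotations N m"
  shows "reverse_embed N z \<in> shift_rotations (Suc N) m"
proof -
  obtain t where z: "z = rotation N (flip_pair N) t"
    and pt: "paired_angles N (flip_pair N) t" and t0: "\<And>i. m \<le> i \<Longrightarrow> i + m < N \<Longrightarrow> t i = 0"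
    using assms by (auto simp: flip_rotations_def)
  define t' where "t' a = (if a = 0 then 0 else t (N - a))" for a
  have "reverse_embed N z = rotation (Suc N) (shift_pair (Suc N)) t'"
    unfolding z by (rule reverse_embed_rotation) (auto simp: t'_def flip_pair_def shift_pair_def)
  moreover have "paired_angles (Suc N) (shift_pair (Suc N)) t'"
    unfolding paired_angles_def
  proof (intro allI impI)
    fix a assume a: "a < Suc N"
    show "shift_pair (Suc N) a < Suc N \<and> shift_pair (Suc N) (shift_pair (Suc N) a) = a
        \<and> t' (shift_pair (Suc N) a) = - t' a"
    proof (cases "a = 0")
      case False
      then have "t (flip_pair N (N - a)) = - t (N - a)" using pt a by (simp add: paired_angles_def)
      moreover have "flip_pair N (N - a) = N - (Suc N - a)" using False a by (auto simp: flip_pair_def)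
      ultimately show ?thesis using False a by (auto simp: t'_def flip_pair_def shift_pair_def)
    qed (auto simp: t'_def flip_pair_def shift_pair_def)
  qed
  moreover have "t' a = 0" if "m < a" "a + m < Suc N" for a
    using that t0[of "N - a"] by (auto simp: t'_def flip_pair_def)
  ultimately show ?thesis unfolding shift_rotations_def by blast
qed

text \<open>The partner of \<open>a = N - i\<close> is now \<open>N - a\<close>, so a
  \<open>B''\<close> factor becomes a \<open>B'\<close> factor. \<open>Suc m\<close> leaves room for
  the plane of the coordinates \<open>0\<close> and \<open>N\<close>, where the corner rotation is
  merged later.\<close>

lemma reverse_embed_shift:
  assumes "y \<in> shift_rotations N m"
  obtains t where "reverse_embed N y = rotation (Suc N) (flip_pair (Suc N)) t"
    "paired_angles (Suc N) (flip_pair (Suc N)) t"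
    "\<And>i. Suc m \<le> i \<Longrightarrow> i + Suc m < Suc N \<Longrightarrow> t i = 0"
proof -
  obtain t where y: "y = rotation N (shift_pair N) t"
    and pt: "paired_angles N (shift_pair N) t" and t0: "\<And>i. m < i \<Longrightarrow> i + m < N \<Longrightarrow> t i = 0"
    using assms by (auto simp: shift_rotations_def)
  have tz: "t 0 = 0" if "0 < N"
  proof -
    have "t (shift_pair N 0) = - t 0" using pt that unfolding paired_angles_def by blast
    then show ?thesis by (simp add: shift_pair_def)
  qed
  define t' where "t' a = (if a = 0 then 0 else if a = N then 0 else t (N - a))" for a
  have 1: "reverse_embed N y = rotation (Suc N) (flip_pair (Suc N)) t'"
    unfolding y
    by (rule reverse_embed_rotation) (use tz in \<open>auto simp: t'_def flip_pair_def shift_pair_def split: if_splits\<close>)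
  have 2: "paired_angles (Suc N) (flip_pair (Suc N)) t'"
    unfolding paired_angles_def
  proof (intro allI impI)
    fix a assume a: "a < Suc N"
    show "flip_pair (Suc N) a < Suc N \<and> flip_pair (Suc N) (flip_pair (Suc N) a) = a
        \<and> t' (flip_pair (Suc N) a) = - t' a"
    proof (cases "a = 0 \<or> a = N")
      case False
      then have "t (shift_pair N a) = - t a" using pt a by (simp add: paired_angles_def)
      then show ?thesis using False a by (auto simp: t'_def flip_pair_def shift_pair_def)
    qed (use a in \<open>auto simp: t'_def flip_pair_def\<close>)
  qed
  have 3: "t' a = 0" if "Suc m \<le> a" "a + Suc m < Suc N" for a
    using that t0[of "N - a"] by (auto simp: t'_def flip_pair_def)
  show thesis using 1 2 3 by (rule that)
qed

section \<open>Splitting off the corner rotation\<close>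

lemma block_unitary_fixes_complement:
  assumes U: "U \<in> unitary_grp n" "fixes_coords n (- S) U" and S: "\<And>i j. i \<in> S \<Longrightarrow> j \<in> S \<Longrightarrow> blk i = blk j"
  shows "U \<in> block_unitary n blk"
  unfolding block_unitary_def
proof (intro CollectI conjI allI impI U)
  fix i j assume "i < n" "j < n" "blk i \<noteq> blk j"
  moreover from this have "i \<in> - S \<or> j \<in> - S" "i \<noteq> j" using S by auto
  ultimately show "U $$ (i,j) = 0" using U(2) by (simp add: fixes_coords_def)
qed

text \<open>The first \<open>p\<close> and the last \<open>q\<close> entries of the row are reduced
  separately, towards positions \<open>0\<close> and \<open>n - 1\<close>. The squares of the two
  remaining real entries add up to \<open>1\<close>, which gives the angle.\<close>

lemma first_row_reduction:
  assumes g: "g \<in> unitary_grp (p + q)" and p: "0 < p" and q: "0 < q"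
  shows "\<exists>h \<in> H_grp p q. \<exists>\<theta>. \<forall>j<p + q. (g * h) $$ (0,j) =
    (if j = 0 then of_real (cos \<theta>) else if j = p + q - 1 then of_real (sin \<theta>) else 0)"
proof -
  define n where "n = p + q"
  have gc: "g \<in> carrier_mat n n" using g by (auto simp: n_def)
  have n: "0 < n" "n - 1 \<noteq> 0" using p q by (auto simp: n_def)
  obtain U a where U: "U \<in> unitary_grp n" "fixes_coords n (- {..<p}) U"
    and a: "\<And>j. j < p \<Longrightarrow> (\<Sum>i<n. g $$ (0,i) * U $$ (i,j)) = (if j = 0 then complex_of_real a else 0)"
    using unitary_row_reduction[of "{..<p}" n 0 "\<lambda>i. g $$ (0,i)"] p by (auto simp: n_def)
  have Uc: "U \<in> carrier_mat n n" using U by auto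
  have "{p..<n} \<subseteq> {..<n}" "n - 1 \<in> {p..<n}" using q by (auto simp: n_def)
  from unitary_row_reduction[OF this, of "\<lambda>i. (g * U) $$ (0,i)"]
  obtain V b where V: "V \<in> unitary_grp n" "fixes_coords n (- {p..<n}) V"
    and b: "\<And>j. p \<le> j \<Longrightarrow> j < n \<Longrightarrow>
      (\<Sum>i<n. (g * U) $$ (0,i) * V $$ (i,j)) = (if j = n - 1 then complex_of_real b else 0)"
    unfolding Ball_def atLeastLessThan_iff by blast
  have Vc: "V \<in> carrier_mat n n" using V by auto
  have H: "U * V \<in> H_grp p q"
    unfolding H_grp_def n_def[symmetric]
    by (rule block_unitary_mult[OF block_unitary_fixes_complement[OF U] block_unitary_fixes_complement[OF V]]) auto
  have row: "(g * (U * V)) $$ (0,j) =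
     (if j = 0 then of_real a else if j = n - 1 then of_real b else 0)" if j: "j < n" for j
  proof -
    have eq: "(g * (U * V)) $$ (0,j) = (\<Sum>i<n. (g * U) $$ (0,i) * V $$ (i,j))"
      using mat_mult_entry[OF square_mult_carrier[OF gc Uc] Vc n(1) j] square_mult_assoc[OF gc Uc Vc]
      by simp
    show ?thesis
    proof (cases "j < p")
      case True
      \<comment> \<open>\<open>V\<close> is the identity on the first \<open>p\<close> coordinates
        and preserves what \<open>U\<close> achieved there.\<close>
      have "(\<Sum>i<n. (g * U) $$ (0,i) * V $$ (i,j)) = (\<Sum>i<n. if i = j then (g * U) $$ (0,j) else 0)"
        using V(2) True j by (intro sum.cong) (auto simp: fixes_coords_def simp del: index_mult_mat)
      also have "\<dots> = (g * U) $$ (0,j)" using j by simp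
      also have "\<dots> = (if j = 0 then complex_of_real a else 0)"
        using mat_mult_entry[OF gc Uc n(1) j] a[OF True] by simp
      finally show ?thesis using eq True q by (auto simp: n_def)
    next
      case False
      then show ?thesis using eq b[of j] j p by simp
    qed
  qed
  have "g * (U * V) \<in> unitary_grp n" using g U V by (simp add: n_def)
  then have "1 = (\<Sum>k<n. (g * (U * V)) $$ (0,k) * cnj ((g * (U * V)) $$ (0,k)))"
    using n by (simp add: unitary_grp_iff del: index_mult_mat)
  also have "\<dots> = (\<Sum>k<n. (if k = 0 then of_real (a\<^sup>2) else 0) + (if k = n - 1 then of_real (b\<^sup>2) else 0))"
    using n by (intro sum.cong) (auto simp: row power2_eq_square simp del: index_mult_mat)
  also have "\<dots> = complex_of_real (a\<^sup>2 + b\<^sup>2)" using n by (simp add: sum.distrib)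
  finally have "a\<^sup>2 + b\<^sup>2 = 1" by (metis of_real_eq_1_iff)
  then obtain \<theta> where "a = cos \<theta>" "b = sin \<theta>" by (rule sincos_total_2pi)
  with H row show ?thesis unfolding n_def by (intro bexI[of _ "U * V"] exI[of _ \<theta>]) auto
qed

definition corner_angles :: "nat \<Rightarrow> real \<Rightarrow> nat \<Rightarrow> real" where
  "corner_angles N \<theta> i = (if i = 0 then \<theta> else if i = N then - \<theta> else 0)"

lemma paired_corner_angles: "0 < N \<Longrightarrow> paired_angles (Suc N) (flip_pair (Suc N)) (corner_angles N \<theta>)"
  by (auto simp: paired_angles_def flip_pair_def corner_angles_def)

text \<open>As \<open>g * h\<close> and \<open>R\<close> have the same first row, the first row of
  \<open>k\<close> is that of \<open>R * ctrans R\<close>, a unit vector; so \<open>k\<close> lies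
  in the image of the embedding.\<close>

lemma corner_factorization:
  assumes g: "g \<in> unitary_grp (Suc N)" and N: "Suc N = p + q" and p: "0 < p" and q: "0 < q"
  obtains u \<theta> h where "u \<in> unitary_grp N" "h \<in> H_grp p q"
    "g = reverse_embed N u * rotation (Suc N) (flip_pair (Suc N)) (corner_angles N \<theta>) * h"
proof -
  obtain h \<theta> where h: "h \<in> H_grp p q" and row: "\<And>j. j < Suc N \<Longrightarrow> (g * h) $$ (0,j) =
    (if j = 0 then of_real (cos \<theta>) else if j = Suc N - 1 then of_real (sin \<theta>) else 0)"
    using first_row_reduction[OF g[unfolded N] p q] unfolding N[symmetric] by blast
  define R where "R = rotation (Suc N) (flip_pair (Suc N)) (corner_angles N \<theta>)"
  have N0: "0 < N" using N p q by auto
  have R: "R \<in> unitary_grp (Suc N)"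
    unfolding R_def by (rule rotation_unitary[OF paired_corner_angles[OF N0]])
  have hU: "h \<in> unitary_grp (Suc N)" using h by (simp add: H_grp_def block_unitary_def N)
  note c = unitary_grp_carrier[OF g] unitary_grp_carrier[OF R] unitary_grp_carrier[OF hU]
    ctrans_carrier[OF unitary_grp_carrier[OF R]] ctrans_carrier[OF unitary_grp_carrier[OF hU]]
  have rowR: "(g * h) $$ (0,j) = R $$ (0,j)" if "j < Suc N" for j
    unfolding row[OF that] using that N0
    by (auto simp: R_def rotation_def flip_pair_def corner_angles_def)
  define k where "k = g * h * ctrans R"
  have "k $$ (0,j) = (if j = 0 then 1 else 0)" if j: "j < Suc N" for j
  proof -
    have "k $$ (0,j) = (\<Sum>l<Suc N. (g * h) $$ (0,l) * ctrans R $$ (l,j))"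
      unfolding k_def using c j by (intro mat_mult_entry) auto
    also have "\<dots> = (\<Sum>l<Suc N. R $$ (0,l) * ctrans R $$ (l,j))"
      by (intro sum.cong) (simp_all add: rowR del: index_mult_mat)
    also have "\<dots> = (R * ctrans R) $$ (0,j)"
      using c j by (intro mat_mult_entry[symmetric]) auto
    also have "\<dots> = (if j = 0 then 1 else 0)" using j by (simp add: unitary_mult_ctrans[OF R])
    finally show ?thesis .
  qed
  moreover have "k \<in> unitary_grp (Suc N)" unfolding k_def using g hU R by simp
  ultimately obtain u where u: "u \<in> unitary_grp N" "k = reverse_embed N u"
    using unitary_first_row_unit[of k N] by blast
  have "k * R * ctrans h = g * (h * ((ctrans R * R) * ctrans h))"
    unfolding k_def using c by (simp add: square_mult_assoc[of _ "Suc N"])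
  also have "\<dots> = g" using c
    by (simp add: ctrans_mult_unitary[OF R] unitary_mult_ctrans[OF hU] left_mult_one_mat[of _ "Suc N" "Suc N"]
       right_mult_one_mat[of _ "Suc N" "Suc N"])
  finally have "g = reverse_embed N u * R * ctrans h" using u by simp
  moreover have "ctrans h \<in> H_grp p q" using h block_unitary_ctrans by (simp add: H_grp_def)
  ultimately show thesis using that u(1) unfolding R_def by blast
qed

text \<open>Reversal carries the blocks of sizes \<open>1\<close>, \<open>q - 1\<close>,
  \<open>p - 1\<close> to \<open>N\<close>, to \<open>p\<close> up to \<open>N - 1\<close>, and to
  \<open>1\<close> up to \<open>p - 1\<close>. The first two form the second block of
  \<open>H\<close>; the third joins the new coordinate \<open>0\<close>.\<close>

lemma reverse_embed_L:
  assumes x: "x \<in> L_grp (q - 1) (p - 1)" and N: "Suc N = p + q" and pq: "0 < p" "0 < q"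
  shows "reverse_embed N x \<in> H_grp p q"
proof -
  have N1: "1 + (q - 1) + (p - 1) = N" using N pq by simp
  have x': "x \<in> unitary_grp N" "\<And>i j. i < N \<Longrightarrow> j < N \<Longrightarrow>
    (if i = 0 then 0 else if i \<le> q - 1 then 1 else (2::nat)) \<noteq> (if j = 0 then 0 else if j \<le> q - 1 then 1 else 2)
      \<Longrightarrow> x $$ (i,j) = 0"
    using x unfolding L_grp_def N1 block_unitary_def by auto
  have "reverse_embed N x $$ (i,j) = 0" if "i < Suc N" "j < Suc N" "(i < p) \<noteq> (j < p)" for i j
  proof (cases "i = 0 \<or> j = 0")
    case False
    have "(N - i \<le> q - 1) \<longleftrightarrow> \<not> i < p" "(N - j \<le> q - 1) \<longleftrightarrow> \<not> j < p" using that N pq by auto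
    then have "x $$ (N - i, N - j) = 0" using that False N pq by (intro x'(2)) auto
    then show ?thesis using that False by (simp add: reverse_embed_entry)
  qed (use that in \<open>auto simp: reverse_embed_entry\<close>)
  then show ?thesis using reverse_embed_unitary[OF x'(1)] N[symmetric]
    by (auto simp: H_grp_def block_unitary_def split: if_splits)
qed

text \<open>Reversal places the block of size \<open>n2\<close> at \<open>1\<close> to
  \<open>n2\<close> and that of size \<open>n3\<close> after it; the new coordinate \<open>0\<close>
  carries the \<open>U(1)\<close> factor.\<close>

lemma reverse_embed_H:
  assumes h: "h \<in> H_grp n3 n2"
  shows "reverse_embed (n2 + n3) h \<in> L_grp n2 n3"
proof -
  define N where "N = n2 + n3"
  have h': "h \<in> unitary_grp N" "\<And>i j. i < N \<Longrightarrow> j < N \<Longrightarrow> (i < n3) \<noteq> (j < n3) \<Longrightarrow> h $$ (i,j) = 0"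
    using h by (auto simp: H_grp_def block_unitary_def N_def add.commute split: if_splits)
  have "reverse_embed N h $$ (i,j) = 0" if ij: "i < Suc N" "j < Suc N"
    "(if i = 0 then 0 else if i \<le> n2 then 1 else (2::nat)) \<noteq> (if j = 0 then 0 else if j \<le> n2 then 1 else 2)" for i j
  proof (cases "i = 0 \<or> j = 0")
    case False
    have "N - i < n3 \<longleftrightarrow> \<not> i \<le> n2" "N - j < n3 \<longleftrightarrow> \<not> j \<le> n2"
      using ij(1,2) False by (auto simp: N_def)
    moreover have "(i \<le> n2) \<noteq> (j \<le> n2)" using ij(3) False by (auto split: if_splits)
    ultimately have "h $$ (N - i, N - j) = 0" using ij(1,2) False by (intro h'(2)) auto
    then show ?thesis using ij(1,2) False by (simp add: reverse_embed_entry)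
  qed (use ij in \<open>auto simp: reverse_embed_entry split: if_splits\<close>)
  moreover have "1 + n2 + n3 = Suc N" by (simp add: N_def)
  ultimately show ?thesis using reverse_embed_unitary[OF h'(1)]
    unfolding N_def[symmetric] by (simp add: L_grp_def block_unitary_def)
qed

text \<open>The \<open>U(1)\<close> entry of \<open>x\<close> moves to the last coordinate; being
  \<open>1\<close>, it leaves the whole corner plane fixed.\<close>

lemma reverse_embed_L_fixes_corners:
  assumes x: "x \<in> L_grp a b" and x0: "x $$ (0,0) = 1" and N: "N = 1 + a + b"
  shows "fixes_coords (Suc N) {0, N} (reverse_embed N x)"
proof -
  have "x $$ (i,j) = (if i = j then 1 else 0)" if "i < N" "j < N" "i = 0 \<or> j = 0" for i j
    using x x0 that unfolding L_grp_def block_unitary_def N by auto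
  then show ?thesis by (auto simp: fixes_coords_def reverse_embed_entry)
qed

lemma corner_rotation_fixes:
  "0 < N \<Longrightarrow> fixes_coords (Suc N) (- {0, N}) (rotation (Suc N) (flip_pair (Suc N)) (corner_angles N \<theta>))"
  by (auto simp: fixes_coords_def rotation_def flip_pair_def corner_angles_def)

text \<open>The normalisation of the \<open>U(1)\<close>-component of \<open>x\<close> makes the induction work: it lets the
  embedded left factor commute with the corner rotation.\<close>

lemma herringbone_decomposition:
  assumes "n = 1 + n2 + n3" "n = p + q" "g \<in> unitary_grp n"
  shows "\<exists>x y z h. x \<in> L_grp n2 n3 \<and> x $$ (0,0) = 1 \<and> h \<in> H_grp p q \<and>
    y \<in> shift_rotations n (min (min p q) (min n2 n3)) \<and>
    z \<in> flip_rotations n (min (min p q) (min (Suc n2) (Suc n3))) \<and> g = x * (y * z) * h"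
  using assms
proof (induction n arbitrary: n2 n3 p q g)
  case (Suc N)
  show ?case
  proof (cases "p = 0 \<or> q = 0")
    \<comment> \<open>Here \<open>H\<close> is the whole unitary group. The induction gets here
      because the next \<open>p\<close> and \<open>q\<close> are \<open>n3\<close> and
      \<open>n2\<close>, and two steps lower all four parameters by one.\<close>
    case True
    have gc: "g \<in> carrier_mat (Suc N) (Suc N)" using Suc.prems by auto
    have "1\<^sub>m (Suc N) \<in> L_grp n2 n3" using Suc.prems(1) block_unitary_one by (simp add: L_grp_def)
    moreover have "g \<in> H_grp p q"
      using True Suc.prems(2,3) by (auto simp: H_grp_def block_unitary_def)
    moreover have "g = 1\<^sub>m (Suc N) * (1\<^sub>m (Suc N) * 1\<^sub>m (Suc N)) * g" using gc by simp
    moreover have "1\<^sub>m (Suc N) $$ (0,0) = (1::complex)" by simp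
    ultimately show ?thesis using shift_rotations_one flip_rotations_one by blast
  next
    case False
    then have pq: "0 < p" "0 < q" by auto
    have N0: "0 < N" using pq Suc.prems(2) by simp
    have Nn: "N = n2 + n3" using Suc.prems(1) by simp
    have N1: "N = 1 + (q - 1) + (p - 1)" using pq Suc.prems(2) by simp
    let ?E = "reverse_embed N"
    obtain u \<theta> h0 where u: "u \<in> unitary_grp N" and h0: "h0 \<in> H_grp p q"
      and gu: "g = ?E u * rotation (Suc N) (flip_pair (Suc N)) (corner_angles N \<theta>) * h0"
      using corner_factorization[OF Suc.prems(3,2) pq] by blast
    define R where "R = rotation (Suc N) (flip_pair (Suc N)) (corner_angles N \<theta>)"
    \<comment> \<open>The plane counts of \<open>B'\<close> and \<open>B''\<close> at size
      \<open>N\<close>; they become those of \<open>B''\<close> and, after adding one plane, of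
      \<open>B'\<close> at size \<open>Suc N\<close>.\<close>
    define m1 where "m1 = min (min n3 n2) (min (Suc (q - 1)) (Suc (p - 1)))"
    define m2 where "m2 = min (min n3 n2) (min (q - 1) (p - 1))"
    have "N = n3 + n2" using Nn by simp
    \<comment> \<open>The inverse of \<open>u\<close> is decomposed: after inverting back,
      \<open>x\<close> stands on the right, next to \<open>R\<close>, and \<open>h\<close> on the
      left.\<close>
    from Suc.IH[OF N1 this unitary_ctrans[OF u]]
    obtain x y z h where x: "x \<in> L_grp (q - 1) (p - 1)" "x $$ (0,0) = 1" and h: "h \<in> H_grp n3 n2"
      and y: "y \<in> shift_rotations N m2" and z: "z \<in> flip_rotations N m1"
      and eq: "ctrans u = x * (y * z) * h"
      unfolding m1_def m2_def by blast
    have m: "m1 = min (min p q) (min n2 n3)" "Suc m2 = min (min p q) (min (Suc n2) (Suc n3))"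
      using pq by (auto simp: m1_def m2_def)
    have yU: "y \<in> unitary_grp N" and zU: "z \<in> unitary_grp N"
      using shift_rotations_unitary[OF y] flip_rotations_unitary[OF z] .
    have xc: "x \<in> carrier_mat N N" using x(1) by (auto simp: L_grp_def block_unitary_def N1)
    have hc: "h \<in> carrier_mat N N"
      using h by (auto simp: H_grp_def block_unitary_def Nn add.commute)
    note c = xc hc unitary_grp_carrier[OF yU] unitary_grp_carrier[OF zU]
    define X where "X = ctrans (?E x)"
    define Y where "Y = ctrans (?E y)"
    define Z where "Z = ctrans (?E z)"
    define K where "K = ctrans (?E h)"
    have C: "X \<in> carrier_mat (Suc N) (Suc N)" "Y \<in> carrier_mat (Suc N) (Suc N)"
      "Z \<in> carrier_mat (Suc N) (Suc N)" "K \<in> carrier_mat (Suc N) (Suc N)"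
      "R \<in> carrier_mat (Suc N) (Suc N)" "h0 \<in> carrier_mat (Suc N) (Suc N)"
      using h0 unfolding X_def Y_def Z_def K_def R_def H_grp_def block_unitary_def Suc.prems(2)[symmetric]
      by auto
    have "?E u = ctrans (?E (ctrans u))"
      using u by (simp add: ctrans_reverse_embed unitary_grp_carrier)
    also have "?E (ctrans u) = ?E x * (?E y * ?E z) * ?E h"
      unfolding eq using c by (simp add: reverse_embed_mult)
    also have "ctrans \<dots> = K * ((Z * Y) * X)"
      unfolding X_def Y_def Z_def K_def by (simp add: ctrans_mult[of _ "Suc N"])
    finally have Eu: "?E u = K * ((Z * Y) * X)" .
    have XR: "X * R = R * X"
    proof (rule fixes_coords_commute)
      show "fixes_coords (Suc N) {0, N} X" unfolding X_def
        by (intro fixes_coords_ctrans reverse_embed_L_fixes_corners[OF x N1]) simp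
      show "fixes_coords (Suc N) (- {0, N}) R" unfolding R_def by (rule corner_rotation_fixes[OF N0])
    qed (use C in auto)
    have "g = K * ((Z * Y) * X) * R * h0" unfolding gu Eu R_def ..
    also have "\<dots> = K * (Z * (Y * (X * R))) * h0"
      using C by (simp add: square_mult_assoc[of _ "Suc N"])
    \<comment> \<open>\<open>X\<close> passes through \<open>R\<close> into the right factor.
      Between \<open>K\<close> and \<open>X * h0\<close> remain \<open>Z\<close>, of type
      \<open>B''\<close>, and \<open>Y * R\<close>, of type \<open>B'\<close>.\<close>
    also have "\<dots> = K * (Z * (Y * R)) * (X * h0)"
      unfolding XR using C by (simp add: square_mult_assoc[of _ "Suc N"])
    finally have geq: "g = K * (Z * (Y * R)) * (X * h0)" .
    have KL: "K \<in> L_grp n2 n3"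
      using block_unitary_ctrans reverse_embed_H[OF h] unfolding K_def Nn L_grp_def by blast
    have K0: "K $$ (0,0) = 1"
      unfolding K_def ctrans_entry[OF reverse_embed_carrier zero_less_Suc zero_less_Suc]
      by (simp add: reverse_embed_entry)
    have XH: "X * h0 \<in> H_grp p q"
      using reverse_embed_L[OF x(1) Suc.prems(2) pq] h0 unfolding X_def H_grp_def
      by (intro block_unitary_mult block_unitary_ctrans)
    have ZB: "Z \<in> shift_rotations (Suc N) m1"
      unfolding Z_def by (rule shift_rotations_ctrans[OF reverse_embed_flip[OF z]])
    obtain t where t: "?E y = rotation (Suc N) (flip_pair (Suc N)) t"
      "paired_angles (Suc N) (flip_pair (Suc N)) t"
      "\<And>i. Suc m2 \<le> i \<Longrightarrow> i + Suc m2 < Suc N \<Longrightarrow> t i = 0"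
      using reverse_embed_shift[OF y] by blast
    have "Y * R = rotation (Suc N) (flip_pair (Suc N)) (\<lambda>i. - t i + corner_angles N \<theta> i)"
      unfolding Y_def R_def t(1) ctrans_rotation[OF t(2)]
      by (rule rotation_mult[OF paired_angles_uminus[OF t(2)] paired_corner_angles[OF N0]])
    moreover have "paired_angles (Suc N) (flip_pair (Suc N)) (\<lambda>i. - t i + corner_angles N \<theta> i)"
      using t(2) paired_corner_angles[OF N0] by (simp add: paired_angles_def)
    \<comment> \<open>The bounds on \<open>i\<close> exclude \<open>0\<close> and \<open>N\<close>,
      so the corner angle does not contribute.\<close>
    moreover have "- t i + corner_angles N \<theta> i = 0" if "Suc m2 \<le> i" "i + Suc m2 < Suc N" for i
      using t(3)[OF that] that by (simp add: corner_angles_def)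
    ultimately have YR: "Y * R \<in> flip_rotations (Suc N) (Suc m2)"
      unfolding flip_rotations_def by blast
    show ?thesis using KL K0 XH ZB YR geq unfolding m by blast
  qed
qed simp

section \<open>The double coset decomposition of the unitary group\<close>

theorem theorem3p1:
  fixes n2 n3 p q n l :: nat
  assumes "0 < n2" "0 < n3" "0 < p" "0 < q"
    and "n = 1 + n2 + n3" "n = p + q"
    and "l = min (min (2*p) (2*q)) (min (2*n2+1) (2*n3+1))"
  shows "unitary_grp n =
    {x * b * h | x b h. x \<in> L_grp n2 n3 \<and> h \<in> H_grp p q \<and>
       b \<in> {y * z | y z. y \<in> mexp ` b2 n (l div 2) \<and> z \<in> mexp ` b1 n ((l+1) div 2)}}"
proof -
  \<comment> \<open>Halving is monotone and passes through the minimum; the odd terms round down to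
    \<open>n2\<close>, \<open>n3\<close> in the first quotient and up to \<open>n2 + 1\<close>,
    \<open>n3 + 1\<close> in the second.\<close>
  have l: "l div 2 = min (min p q) (min n2 n3)"
    "(l + 1) div 2 = min (min p q) (min (Suc n2) (Suc n3))"
    using assms(7) by (auto simp: min_def)
  \<comment> \<open>The number of planes is at most the mean of \<open>n2\<close> and
    \<open>n3\<close> here, and of \<open>p\<close> and \<open>q\<close> for \<open>B1\<close>,
    which gives the bounds the exponentials require.\<close>
  have B2: "mexp ` b2 n (l div 2) = shift_rotations n (l div 2)"
    using assms(5) l(1) by (intro exp_b2) auto
  have B1: "mexp ` b1 n ((l + 1) div 2) = flip_rotations n ((l + 1) div 2)"
    using assms(6) l(2) by (intro exp_b1) (auto simp: min_def)
  show ?thesis unfolding B1 B2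
  proof (intro equalityI subsetI)
    fix g assume "g \<in> unitary_grp n"
    from herringbone_decomposition[OF assms(5,6) this]
    show "g \<in> {x * b * h | x b h. x \<in> L_grp n2 n3 \<and> h \<in> H_grp p q \<and>
       b \<in> {y * z | y z. y \<in> shift_rotations n (l div 2) \<and> z \<in> flip_rotations n ((l+1) div 2)}}"
      unfolding l by blast
  next
    fix g assume "g \<in> {x * b * h | x b h. x \<in> L_grp n2 n3 \<and> h \<in> H_grp p q \<and>
       b \<in> {y * z | y z. y \<in> shift_rotations n (l div 2) \<and> z \<in> flip_rotations n ((l+1) div 2)}}"
    then obtain x y z h where g: "g = x * (y * z) * h" and x: "x \<in> L_grp n2 n3" and h: "h \<in> H_grp p q"
      and "y \<in> shift_rotations n (l div 2)" "z \<in> flip_rotations n ((l+1) div 2)" by blast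
    then have "y \<in> unitary_grp n" "z \<in> unitary_grp n"
      using shift_rotations_unitary flip_rotations_unitary by blast+
    moreover have "x \<in> unitary_grp n" using x assms(5) by (simp add: L_grp_def block_unitary_def)
    moreover have "h \<in> unitary_grp n" using h assms(6) by (simp add: H_grp_def block_unitary_def)
    ultimately show "g \<in> unitary_grp n" unfolding g by (intro unitary_mult)
  qed
qed

end
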